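(* Let $M$ be a numerical monoid with Frobenius number $g\ge1$. Then $M$ is symmetric if and only if there is just one numerical set (which must be $M$ itself) whose atom monoid is $M$. If $M$ is a pseudosymmetric numerical monoid, then there are precisely two numerical sets (which must be $M$ and $M^*$) whose atom monoid is $M$.
   Context: A numerical set is a cofinite subset $S\subseteq\mathbb N=\{0,1,2,\dots\}$ containing $0$; for $S\ne\mathbb N$ its Frobenius number is $g=\max(\mathbb N-S)$. A numerical monoid is a numerical set closed under addition. The atom monoid of $S$ is $A(S)=\{n\in\mathbb Z: n+S\subseteq S\}$; it is a numerical monoid with the same Frobenius number as $S$. The dual of a numerical set $S$ with Frobenius number $g$ is $S^*=\{n\in\mathbb Z: g-n\notin S\}$. $S$ is symmetric if for every integer $x$: $x\in S\iff g-x\notin S$. $S$ is pseudosymmetric if $g$ is even, $g/2\notin S$, and for every integer $x\neq g/2$: $x\in S\iff g-x\notin S$. *)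

theory Defs
  imports Main
begin

text \<open>
  Numerical sets are sets of non-negative integers.  They are represented as subsets of
  \<open>\<nat> :: int set\<close> rather than as sets of type \<open>nat set\<close>, because the atom monoid, the dual
  and (pseudo)symmetry all quantify over arbitrary integers.
\<close>

definition numerical_set :: "int set \<Rightarrow> bool" where
  "numerical_set S \<longleftrightarrow> S \<subseteq> \<nat> \<and> finite (\<nat> - S) \<and> 0 \<in> S"

definition numerical_monoid :: "int set \<Rightarrow> bool" where
  "numerical_monoid M \<longleftrightarrow> numerical_set M \<and> (\<forall>a\<in>M. \<forall>b\<in>M. a + b \<in> M)"

text \<open>Only meaningful for a numerical set other than \<open>\<nat>\<close>; \<open>Max {}\<close> is unspecified.\<close>

definition frobenius :: "int set \<Rightarrow> int" where
  "frobenius S = Max (\<nat> - S)"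

definition atom_monoid :: "int set \<Rightarrow> int set" where
  "atom_monoid S = {n. (\<lambda>s. n + s) ` S \<subseteq> S}"

definition dual :: "int set \<Rightarrow> int set" where
  "dual S = {n. frobenius S - n \<notin> S}"

definition symmetric :: "int set \<Rightarrow> bool" where
  "symmetric S \<longleftrightarrow> (\<forall>x. x \<in> S \<longleftrightarrow> frobenius S - x \<notin> S)"

definition pseudosymmetric :: "int set \<Rightarrow> bool" where
  "pseudosymmetric S \<longleftrightarrow>
     even (frobenius S) \<and> frobenius S div 2 \<notin> S \<and>
     (\<forall>x. x \<noteq> frobenius S div 2 \<longrightarrow> (x \<in> S \<longleftrightarrow> frobenius S - x \<notin> S))"

end

theory Submission
  imports Defs
begin

text \<open>
  The numerical sets with atom monoid \<open>M\<close> all lie between \<open>M\<close> and \<open>dual M\<close>: if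
  \<open>s \<in> S\<close> and \<open>g - s \<in> atom_monoid S\<close>, then \<open>g \<in> S\<close>, which is impossible.  Both \<open>M\<close> and
  \<open>dual M\<close> have atom monoid \<open>M\<close>.  Symmetry of \<open>M\<close> says that the two bounds coincide, and
  pseudosymmetry says that they differ exactly in the point \<open>g / 2\<close>.
\<close>

lemma frobenius_eqI:
  assumes "numerical_set S" "g \<in> \<nat>" "g \<notin> S" "\<And>n. n > g \<Longrightarrow> n \<in> S"
  shows "frobenius S = g"
  unfolding frobenius_def
proof (rule Max_eqI)
  show "finite (\<nat> - S)" "g \<in> \<nat> - S"
    using assms by (auto simp: numerical_set_def)
  show "n \<le> g" if "n \<in> \<nat> - S" for n
    using that assms(4)[of n] by (meson DiffD2 not_less)
qed

lemma frobenius_in_diff: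
  assumes "numerical_set S" "S \<noteq> \<nat>"
  shows "frobenius S \<in> \<nat> - S"
  unfolding frobenius_def
  using assms by (intro Max_in) (auto simp: numerical_set_def)

lemma frobenius_not_mem:
  assumes "numerical_set S" "S \<noteq> \<nat>"
  shows "frobenius S \<notin> S"
  using frobenius_in_diff[OF assms] by blast

lemma mem_if_gt_frobenius:
  assumes "numerical_set S" "S \<noteq> \<nat>" "n > frobenius S"
  shows "n \<in> S"
proof (rule ccontr)
  assume "n \<notin> S"
  \<comment> \<open>\<open>Max\<close> only bounds the gaps inside \<nat>, so \<open>n\<close> must
    first be seen to be non-negative. This follows from \<open>n > frobenius S\<close> and
    \<open>frobenius S\<close> being itself a gap in \<nat>.\<close>
  moreover have "n \<in> \<nat>"
    using frobenius_in_diff[OF assms(1,2)] assms(3) by (auto simp: Nats_altdef1)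
  ultimately have "n \<le> frobenius S"
    unfolding frobenius_def using assms(1) by (intro Max_ge) (auto simp: numerical_set_def)
  then show False using assms(3) by simp
qed

lemma numerical_set_nonneg: "numerical_set S \<Longrightarrow> x \<in> S \<Longrightarrow> 0 \<le> x"
  by (auto simp: numerical_set_def Nats_altdef1)

lemma mem_atom_monoid_iff: "n \<in> atom_monoid S \<longleftrightarrow> (\<forall>s\<in>S. n + s \<in> S)"
  by (auto simp: atom_monoid_def)

lemma atom_monoid_subset: "0 \<in> S \<Longrightarrow> atom_monoid S \<subseteq> S"
  using mem_atom_monoid_iff by fastforce

text \<open>Elements of \<open>S\<close> are non-negative, so such a shift carries all of them past
  the last gap.\<close>

lemma mem_atom_monoid_if_gt_frobenius:
  assumes "numerical_set S" "S \<noteq> \<nat>" "n > frobenius S"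
  shows "n \<in> atom_monoid S"
  unfolding mem_atom_monoid_iff
proof
  fix s assume "s \<in> S"
  then have "n + s > frobenius S"
    using numerical_set_nonneg[OF assms(1)] assms(3) by fastforce
  then show "n + s \<in> S"
    by (rule mem_if_gt_frobenius[OF assms(1,2)])
qed

lemma numerical_set_atom_monoid:
  assumes "numerical_set S" "S \<noteq> \<nat>"
  shows "numerical_set (atom_monoid S)"
proof -
  have "\<nat> - atom_monoid S \<subseteq> {0..frobenius S}"
    using mem_atom_monoid_if_gt_frobenius[OF assms] by (force simp: Nats_altdef1)
  then have "finite (\<nat> - atom_monoid S)"
    using finite_subset by blast
  moreover have "0 \<in> atom_monoid S"
    by (simp add: atom_monoid_def)
  moreover have "atom_monoid S \<subseteq> \<nat>"
    using atom_monoid_subset[of S] assms(1) by (auto simp: numerical_set_def)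
  ultimately show ?thesis
    by (simp add: numerical_set_def)
qed

text \<open>This makes \<open>dual (atom_monoid S)\<close> a reflection about the same number as
  \<open>dual S\<close>. The gap survives because \<open>0 \<in> S\<close> puts the atom monoid
  inside \<open>S\<close>.\<close>

lemma frobenius_atom_monoid:
  assumes "numerical_set S" "S \<noteq> \<nat>"
  shows "frobenius (atom_monoid S) = frobenius S"
proof (rule frobenius_eqI)
  show "numerical_set (atom_monoid S)"
    by (rule numerical_set_atom_monoid[OF assms])
  show "frobenius S \<in> \<nat>"
    using frobenius_in_diff[OF assms] by blast
  show "frobenius S \<notin> atom_monoid S"
    using frobenius_not_mem[OF assms] atom_monoid_subset[of S] assms(1)
    by (auto simp: numerical_set_def)
  show "n \<in> atom_monoid S" if "n > frobenius S" for n
    by (rule mem_atom_monoid_if_gt_frobenius[OF assms that])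
qed

lemma atom_monoid_numerical_monoid:
  assumes "numerical_monoid M"
  shows "atom_monoid M = M"
proof
  show "atom_monoid M \<subseteq> M"
    using assms by (intro atom_monoid_subset) (simp add: numerical_monoid_def numerical_set_def)
  show "M \<subseteq> atom_monoid M"
    using assms unfolding numerical_monoid_def by (meson mem_atom_monoid_iff subsetI)
qed

lemma numerical_set_subset_dual_atom_monoid:
  assumes "numerical_set S" "S \<noteq> \<nat>"
  shows "S \<subseteq> dual (atom_monoid S)"
proof
  fix s assume "s \<in> S"
  then have "frobenius S - s \<notin> atom_monoid S"
    using frobenius_not_mem[OF assms] unfolding mem_atom_monoid_iff
    by (metis diff_add_cancel)
  then show "s \<in> dual (atom_monoid S)"
    by (simp add: dual_def frobenius_atom_monoid[OF assms])
qed

text \<open>Write g for the Frobenius number. A negative x has g - x > g, hence in \<open>S\<close>,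
  so x is not in the dual. An x > g has g - x < 0, hence outside \<open>S\<close>, so the gaps of
  the dual are at most g.\<close>

lemma numerical_set_dual:
  assumes "numerical_set S" "S \<noteq> \<nat>"
  shows "numerical_set (dual S)"
proof -
  have "dual S \<subseteq> \<nat>"
  proof
    fix x assume "x \<in> dual S"
    then have "\<not> frobenius S < frobenius S - x"
      using mem_if_gt_frobenius[OF assms] unfolding dual_def by blast
    then show "x \<in> \<nat>"
      by (simp add: Nats_altdef1)
  qed
  moreover have "\<nat> - dual S \<subseteq> {0..frobenius S}"
    using numerical_set_nonneg[OF assms(1)] by (fastforce simp: dual_def Nats_altdef1)
  then have "finite (\<nat> - dual S)"
    using finite_subset by blast
  moreover have "0 \<in> dual S"
    using frobenius_not_mem[OF assms] by (simp add: dual_def)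
  ultimately show ?thesis
    by (simp add: numerical_set_def)
qed

text \<open>Let g be the Frobenius number of \<open>M\<close>. For n in \<open>M\<close>, if g - (n
  + x) were in \<open>M\<close>, adding n would put g - x in \<open>M\<close>, so x would not be in
  the dual. Conversely, if n is not in \<open>M\<close>, then g - n is in the dual, and shifting it
  by n gives g, which is not in the dual because \<open>0 \<in> M\<close>.\<close>

lemma atom_monoid_dual:
  assumes "numerical_monoid M"
  shows "atom_monoid (dual M) = M"
proof
  show "M \<subseteq> atom_monoid (dual M)"
  proof
    fix n assume n: "n \<in> M"
    have "n + x \<in> dual M" if "x \<in> dual M" for x
    proof -
      have False if "frobenius M - (n + x) \<in> M"
      proof -
        have "n + (frobenius M - (n + x)) \<in> M"
          using assms n that unfolding numerical_monoid_def by blast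
        then show False
          using \<open>x \<in> dual M\<close> by (simp add: dual_def)
      qed
      then show ?thesis
        by (auto simp: dual_def)
    qed
    then show "n \<in> atom_monoid (dual M)"
      by (simp add: mem_atom_monoid_iff)
  qed
  show "atom_monoid (dual M) \<subseteq> M"
  proof
    fix n assume n: "n \<in> atom_monoid (dual M)"
    show "n \<in> M"
    proof (rule ccontr)
      assume "n \<notin> M"
      then have "frobenius M - n \<in> dual M"
        by (simp add: dual_def)
      then have "n + (frobenius M - n) \<in> dual M"
        using n unfolding mem_atom_monoid_iff by blast
      then show False
        using assms by (simp add: dual_def numerical_monoid_def numerical_set_def)
    qed
  qed
qed

lemma symmetric_iff_dual_eq: "symmetric S \<longleftrightarrow> dual S = S"
  by (auto simp: symmetric_def dual_def set_eq_iff)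

lemma dual_pseudosymmetric:
  assumes "pseudosymmetric S"
  shows "dual S = insert (frobenius S div 2) S"
proof -
  have "even (frobenius S)"
    using assms unfolding pseudosymmetric_def by blast
  \<comment> \<open>Evenness makes the integer division exact, so this point is fixed by the
    reflection that defines \<open>dual\<close>.\<close>
  then have half: "frobenius S - frobenius S div 2 = frobenius S div 2"
    by presburger
  have "x \<in> dual S \<longleftrightarrow> x \<in> insert (frobenius S div 2) S" for x
  proof (cases "x = frobenius S div 2")
    case True
    then show ?thesis
      using assms half unfolding pseudosymmetric_def dual_def by (metis insertI1 mem_Collect_eq)
  next
    case False
    then show ?thesis
      using assms unfolding pseudosymmetric_def dual_def by blast
  qed
  then show ?thesis
    by blast
qed

theorem corollary2:
  fixes M :: "int set"
  assumes "numerical_monoid M" and "M \<noteq> \<nat>" and "frobenius M \<ge> 1"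
  shows "(symmetric M \<longleftrightarrow> (\<exists>!S. numerical_set S \<and> atom_monoid S = M)) \<and>
         ((\<exists>!S. numerical_set S \<and> atom_monoid S = M) \<longrightarrow>
            {S. numerical_set S \<and> atom_monoid S = M} = {M}) \<and>
         (pseudosymmetric M \<longrightarrow>
            card {S. numerical_set S \<and> atom_monoid S = M} = 2 \<and>
            {S. numerical_set S \<and> atom_monoid S = M} = {M, dual M})"
proof -
  let ?P = "\<lambda>S. numerical_set S \<and> atom_monoid S = M"
  have M: "numerical_set M"
    using assms(1) by (simp add: numerical_monoid_def)
  have P_M: "?P M"
    using M atom_monoid_numerical_monoid[OF assms(1)] by simp
  have P_dual: "?P (dual M)"
    using numerical_set_dual[OF M assms(2)] atom_monoid_dual[OF assms(1)] by simp
  have between: "M \<subseteq> S \<and> S \<subseteq> dual M" if "?P S" for S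
  proof -
    \<comment> \<open>The case \<open>S = \<nat>\<close>, where \<open>frobenius S\<close> is
      unspecified, has to be excluded first: \<nat> is its own atom monoid and differs from
      \<open>M\<close>.\<close>
    have "numerical_monoid \<nat>"
      by (simp add: numerical_monoid_def numerical_set_def)
    then have "S \<noteq> \<nat>"
      using that assms(2) atom_monoid_numerical_monoid by blast
    then show ?thesis
      using that numerical_set_subset_dual_atom_monoid atom_monoid_subset
      by (auto simp: numerical_set_def)
  qed
  have "symmetric M \<longleftrightarrow> (\<exists>!S. ?P S)"
    \<comment> \<open>If the bounds coincide, every candidate is squeezed to \<open>M\<close>.
      Conversely, \<open>M\<close> and \<open>dual M\<close> are both candidates, so uniqueness
      identifies them.\<close>
    unfolding symmetric_iff_dual_eq using P_M P_dual between by (metis subset_antisym)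
  moreover have "(\<exists>!S. ?P S) \<longrightarrow> {S. ?P S} = {M}"
    using P_M by blast
  moreover have "card {S. ?P S} = 2 \<and> {S. ?P S} = {M, dual M}" if "pseudosymmetric M"
  proof -
    have dual: "dual M = insert (frobenius M div 2) M"
      by (rule dual_pseudosymmetric[OF that])
    \<comment> \<open>The bounds differ by a single point, so nothing lies strictly between
      them.\<close>
    have "S = M \<or> S = dual M" if "?P S" for S
      using between[OF that] unfolding dual by blast
    then have "{S. ?P S} = {M, dual M}"
      using P_M P_dual by blast
    moreover have "M \<noteq> dual M"
      using that unfolding dual pseudosymmetric_def by blast
    ultimately show ?thesis
      by simp
  qed
  ultimately show ?thesis
    by blast
qed

end
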